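(* Let $K\subset\mathbf{E}^d$ and $R>0$. Assume that $K$ admits an $R$-hull $\hat K$. Then $\mathrm{reach}(K'_R)\ge R$.
   Context: $\mathbf{E}^d$ is $d$-dimensional Euclidean space, with norm $\|\cdot\|$. $B(x,r)$ denotes the open ball with center $x$ and radius $r>0$. For $A\subset\mathbf{E}^d$, $\delta_A(a)=\inf\{\|a-x\|: x\in A\}$ is the distance from $a$ to $A$ (with $\delta_\emptyset\equiv+\infty$). For a closed set $K\subset\mathbf{E}^d$, $\mathrm{Unp}(K)$ is the set of points $a\in\mathbf{E}^d$ for which there is a unique $x\in K$ with $\delta_K(a)=\|a-x\|$. For $a\in K$, $\mathrm{reach}(K,a)=\sup\{r>0: B(a,r)\subset\mathrm{Unp}(K)\}$ (with value $0$ if there is no such $r$), and $\mathrm{reach}(K)=\inf_{a\in K}\mathrm{reach}(K,a)\in[0,\infty]$, with the convention $\inf\emptyset=+\infty$. Reach is defined only for closed sets, so an assertion $\mathrm{reach}(K)\ge R$ includes that $K$ is closed. For any $A\subset\mathbf{E}^d$ and $R>0$, $A'_R=\{x\in\mathbf{E}^d: \delta_A(x)\ge R\}$. A set $A\subset\mathbf{E}^d$ admits an $R$-hull if there exists $\hat A\subset\mathbf{E}^d$ such that: (i) $A\subset\hat A$; (ii) $\mathrm{reach}(\hat A)\ge R$; (iii) whenever $\mathrm{reach}(L)\ge R$ and $A\subset L$, one has $\hat A\subset L$. Such a set $\hat A$ (necessarily unique) is called the $R$-hull of $A$. *)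

theory Defs
  imports "HOL-Analysis.Analysis"
begin

text \<open>
  Distances and reaches are extended nonnegative reals, in which the infimum of the empty set
  is \<open>\<infinity>\<close> and its supremum is 0. The library's \<^const>\<open>infdist\<close> is not used for
  the distance, because it is 0 on the empty set.
\<close>

definition set_distance :: "'a::euclidean_space set \<Rightarrow> 'a \<Rightarrow> ennreal"
  where "set_distance A a = (INF x\<in>A. ennreal (norm (a - x)))"

definition Unp :: "'a::euclidean_space set \<Rightarrow> 'a set"
  where "Unp K = {a. \<exists>!x. x \<in> K \<and> set_distance K a = ennreal (norm (a - x))}"

definition reach_at :: "'a::euclidean_space set \<Rightarrow> 'a \<Rightarrow> ennreal"
  where "reach_at K a = Sup {ennreal r | r. r > 0 \<and> ball a r \<subseteq> Unp K}"

definition reach :: "'a::euclidean_space set \<Rightarrow> ennreal"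
  where "reach K = (INF a\<in>K. reach_at K a)"

text \<open>
  Reach is a notion for closed sets only, so a lower bound on it includes closedness.
\<close>

definition reach_at_least :: "real \<Rightarrow> 'a::euclidean_space set \<Rightarrow> bool"
  where "reach_at_least R K \<longleftrightarrow> closed K \<and> reach K \<ge> ennreal R"

definition far_set :: "real \<Rightarrow> 'a::euclidean_space set \<Rightarrow> 'a set"
  where "far_set R A = {x. set_distance A x \<ge> ennreal R}"

definition is_R_hull :: "real \<Rightarrow> 'a::euclidean_space set \<Rightarrow> 'a set \<Rightarrow> bool"
  where "is_R_hull R A H \<longleftrightarrow>
    A \<subseteq> H \<and> reach_at_least R H \<and> (\<forall>L. reach_at_least R L \<and> A \<subseteq> L \<longrightarrow> H \<subseteq> L)"

definition admits_R_hull :: "real \<Rightarrow> 'a::euclidean_space set \<Rightarrow> bool"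
  where "admits_R_hull R A \<longleftrightarrow> (\<exists>H. is_R_hull R A H)"

end

theory Submission
  imports Defs
begin

text \<open>
  A ball \<open>B(x, R)\<close> missing \<open>K\<close> has a complement of reach at least \<open>R\<close>, so it also misses the
  \<open>R\<close>-hull; hence \<open>K\<close> may be replaced by its hull, that is, assumed to have reach at least \<open>R\<close>.
  For such \<open>K\<close>, let \<open>y\<close> have distance \<open>\<rho>\<close> with \<open>0 < \<rho> < R\<close> from \<open>K\<close> and nearest point \<open>p\<close>.
  Brouwer's theorem shows that the point \<open>z\<close> at distance \<open>R\<close> from \<open>p\<close> on the ray from \<open>p\<close> through
  \<open>y\<close> has distance \<open>R\<close> from \<open>K\<close>. A point \<open>x\<close> of \<open>K'\<^sub>R\<close> nearest to \<open>y\<close> then satisfies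
  \<open>R \<le> |x - p| \<le> |x - y| + |y - p| \<le> (R - \<rho>) + \<rho>\<close>, and equality in the triangle inequality
  forces \<open>x = z\<close>.
\<close>

lemma infdist_less_iff:
  assumes "A \<noteq> {}"
  shows "infdist y A < r \<longleftrightarrow> (\<exists>a\<in>A. dist y a < r)"
  unfolding infdist_notempty[OF assms] by (rule cINF_less_iff) (auto simp: assms)

lemma dist_closest_point_eq_infdist:
  assumes "closed A" "A \<noteq> {}"
  shows "dist x (closest_point A x) = infdist x A"
  using setdist_closest_point[OF assms] by (simp add: infdist_eq_setdist)

lemma set_distance_eq_infdist:
  assumes "A \<noteq> {}"
  shows "set_distance A a = ennreal (infdist a A)"
proof (rule antisym)
  show "ennreal (infdist a A) \<le> set_distance A a"
    unfolding set_distance_def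
    by (rule INF_greatest) (auto intro!: ennreal_leI infdist_le simp flip: dist_norm)
  show "set_distance A a \<le> ennreal (infdist a A)"
  proof (rule ennreal_le_epsilon)
    fix e :: real
    assume "e > 0"
    then obtain x where x: "x \<in> A" "dist a x < infdist a A + e"
      using infdist_less_iff[OF assms, of a "infdist a A + e"] by auto
    have "set_distance A a \<le> ennreal (norm (a - x))"
      unfolding set_distance_def using x by (intro INF_lower)
    also have "\<dots> \<le> ennreal (infdist a A + e)"
      using x by (intro ennreal_leI) (simp add: dist_norm)
    also have "\<dots> = ennreal (infdist a A) + ennreal e"
      using \<open>e > 0\<close> by (simp add: infdist_nonneg)
    finally show "set_distance A a \<le> ennreal (infdist a A) + ennreal e" .
  qed
qed

lemma Unp_iff:
  assumes "A \<noteq> {}"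
  shows "a \<in> Unp A \<longleftrightarrow> (\<exists>!x. x \<in> A \<and> dist a x = infdist a A)"
  unfolding Unp_def mem_Collect_eq set_distance_eq_infdist[OF assms]
  by (simp add: infdist_nonneg dist_norm eq_commute)

text \<open>The supremum need not be attained, but each \<open>y\<close> in the open ball still lies
  in some admissible ball, of a radius \<open>r\<close> exceeding \<open>dist a y\<close>.\<close>

lemma ennreal_le_reach_at_iff:
  assumes "R > 0"
  shows "ennreal R \<le> reach_at A a \<longleftrightarrow> ball a R \<subseteq> Unp A"
proof
  assume R: "ennreal R \<le> reach_at A a"
  show "ball a R \<subseteq> Unp A"
  proof
    fix y
    assume "y \<in> ball a R"
    then have "ennreal (dist a y) < ennreal R"
      by (simp add: ennreal_lessI assms)
    also note R
    finally obtain r where "r > 0" "ball a r \<subseteq> Unp A" "ennreal (dist a y) < ennreal r"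
      unfolding reach_at_def less_Sup_iff by blast
    then show "y \<in> Unp A"
      by (auto simp: ennreal_less_iff)
  qed
next
  assume "ball a R \<subseteq> Unp A"
  then show "ennreal R \<le> reach_at A a"
    unfolding reach_at_def using assms by (intro Sup_upper) auto
qed

lemma reach_at_least_iff_ball:
  assumes "R > 0"
  shows "reach_at_least R L \<longleftrightarrow> closed L \<and> (\<forall>a\<in>L. ball a R \<subseteq> Unp L)"
  unfolding reach_at_least_def reach_def
  by (simp add: le_INF_iff ennreal_le_reach_at_iff[OF assms])

text \<open>The balls of radius \<open>R\<close> around points of \<open>L\<close> cover exactly the
  points at distance less than \<open>R\<close> from \<open>L\<close>.\<close>

lemma reach_at_least_iff_infdist:
  assumes "R > 0" "L \<noteq> {}"
  shows "reach_at_least R L \<longleftrightarrow>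
    closed L \<and> (\<forall>y. infdist y L < R \<longrightarrow> (\<exists>!x. x \<in> L \<and> dist y x = infdist y L))"
proof -
  have "(\<exists>a\<in>L. y \<in> ball a R) \<longleftrightarrow> infdist y L < R" for y
    using infdist_less_iff[OF assms(2)] by (simp add: dist_commute)
  then show ?thesis
    unfolding reach_at_least_iff_ball[OF assms(1)] subset_iff Unp_iff[OF assms(2)] by blast
qed

lemma mem_far_set_iff:
  assumes "R > 0"
  shows "x \<in> far_set R A \<longleftrightarrow> A \<subseteq> - ball x R"
  using assms by (auto simp: far_set_def set_distance_def le_INF_iff dist_norm subset_iff not_less)

text \<open>Strict convexity of the Euclidean norm; it serves to show that nearest points are
  unique.\<close>

lemma dist_triangle_eq_imp_ray:
  fixes p y x :: "'a::euclidean_space"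
  assumes "p \<noteq> y" "dist p x = dist p y + dist y x"
  shows "x = y + (dist y x / dist p y) *\<^sub>R (y - p)"
proof -
  have "norm ((y - p) + (x - y)) = norm (y - p) + norm (x - y)"
    using assms(2) by (simp add: dist_norm norm_minus_commute)
  then have "dist p y *\<^sub>R (x - y) = dist y x *\<^sub>R (y - p)"
    unfolding norm_triangle_eq dist_norm norm_minus_commute[of p] norm_minus_commute[of y x] .
  then have "(1 / dist p y) *\<^sub>R (dist p y *\<^sub>R (x - y)) = (1 / dist p y) *\<^sub>R (dist y x *\<^sub>R (y - p))"
    by (rule arg_cong)
  then have "x - y = (dist y x / dist p y) *\<^sub>R (y - p)"
    using assms(1) by simp
  then show ?thesis
    by (simp add: algebra_simps)
qed

lemma reach_at_least_Compl_ball: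
  fixes x :: "'a::euclidean_space"
  assumes "R > 0"
  shows "reach_at_least R (- ball x R)"
proof -
  obtain e :: 'a where e: "norm e = 1"
    using norm_Basis nonempty_Basis by blast
  then have "x + R *\<^sub>R e \<in> - ball x R"
    using assms by (simp add: dist_norm)
  then have ne: "- ball x R \<noteq> {}"
    by blast
  have "\<exists>!z. z \<in> - ball x R \<and> dist y z = infdist y (- ball x R)"
    if y: "infdist y (- ball x R) < R" for y
  proof (cases "y \<in> ball x R")
    case False
    then show ?thesis by auto
  next
    case True
    obtain w where w: "w \<in> - ball x R" "infdist y (- ball x R) = dist y w"
      using infdist_attains_inf[OF _ ne, of y] by auto
    \<comment> \<open>The centre has distance at least \<open>R\<close> from the complement, so the
      bound on \<open>infdist\<close> excludes it.\<close>
    have yx: "y \<noteq> x"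
      using y w by auto
    \<comment> \<open>The ray from \<open>x\<close> through \<open>y\<close> leaves the ball at
      \<open>z\<close>.\<close>
    define z where "z = y + ((R - dist x y) / dist x y) *\<^sub>R (y - x)"
    have "z - x = (R / dist x y) *\<^sub>R (y - x)"
      using yx by (simp add: z_def diff_divide_distrib algebra_simps)
    then have zx: "dist x z = R"
      using yx assms by (simp add: dist_norm norm_minus_commute[of x])
    have yz: "dist y z = R - dist x y"
      using yx True by (simp add: z_def dist_norm norm_minus_commute[of x])
    have le: "infdist y (- ball x R) \<le> R - dist x y"
      using infdist_le[of z "- ball x R" y] zx yz by simp
    have "v = z" if v: "v \<in> - ball x R" "dist y v = infdist y (- ball x R)" for v
    proof -
      have "dist y v = R - dist x y"
        using v le dist_triangle[of x v y] by auto
      moreover from this have "dist x v = dist x y + dist y v"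
        using v dist_triangle[of x v y] by auto
      ultimately show ?thesis
        using dist_triangle_eq_imp_ray[of x y v] yx by (simp add: z_def)
    qed
    with w show ?thesis by metis
  qed
  then show ?thesis
    using ne by (simp add: reach_at_least_iff_infdist[OF assms] closed_Compl)
qed

text \<open>One inclusion comes from \<open>K \<subseteq> H\<close>, the other from minimality of
  \<open>H\<close> against the complement of \<open>ball x R\<close>.\<close>

lemma far_set_R_hull:
  assumes "R > 0" "is_R_hull R K H"
  shows "far_set R H = far_set R K"
  using assms reach_at_least_Compl_ball[OF assms(1)]
  unfolding set_eq_iff mem_far_set_iff[OF assms(1)] is_R_hull_def by blast

text \<open>By uniqueness the graph is the closed set of pairs realizing the distance; since
  \<open>S\<close> is compact the values stay in a fixed closed ball, so a closed graph gives
  continuity.\<close>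

lemma continuous_on_closest_point_unique:
  fixes K :: "'a::euclidean_space set"
  assumes "closed K" "K \<noteq> {}" "bounded S" "closed S"
    and uniq: "\<And>x. x \<in> S \<Longrightarrow> \<exists>!z. z \<in> K \<and> dist x z = infdist x K"
  shows "continuous_on S (closest_point K)"
proof -
  note cp = closest_point_in_set[OF assms(1,2)] dist_closest_point_eq_infdist[OF assms(1,2)]
  have "compact S"
    using assms by (simp add: compact_eq_bounded_closed)
  then have "compact ((\<lambda>x. infdist x K) ` S)"
    by (intro compact_continuous_image continuous_intros)
  then obtain B where B: "\<And>x. x \<in> S \<Longrightarrow> infdist x K \<le> B"
    by (meson bdd_above.E bounded_imp_bdd_above compact_imp_bounded imageI)
  obtain a C where C: "S \<subseteq> cball a C"
    using \<open>bounded S\<close> bounded_subset_cball by blast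
  have "closest_point K x \<in> cball a (C + B)" if "x \<in> S" for x
    using C B[OF that] cp(2)[of x] dist_triangle[of a "closest_point K x" x] that by fastforce
  moreover have "closed ((S \<times> K) \<inter> {v. dist (fst v) (snd v) = infdist (fst v) K})"
    by (intro closed_Int closed_Collect_eq continuous_intros closed_Times assms)
  moreover have "(\<lambda>x. (x, closest_point K x)) ` S =
      (S \<times> K) \<inter> {v. dist (fst v) (snd v) = infdist (fst v) K}"
    using cp uniq by (force simp: image_iff)
  ultimately show ?thesis
    by (intro continuous_from_closed_graph[of "cball a (C + B)"]) auto
qed

text \<open>The strict bound in \<open>s\<close> keeps all of \<open>cball y s\<close> where nearest
  points are unique, so the projection is continuous there and Brouwer's theorem applies.\<close>

lemma infdist_along_ray:
  fixes K :: "'a::euclidean_space set"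
  assumes "reach_at_least R K" "p \<in> K" "dist y p = infdist y K" "0 < infdist y K"
    and s: "0 < s" "infdist y K + s < R"
  shows "infdist (y + (s / infdist y K) *\<^sub>R (y - p)) K = infdist y K + s"
proof -
  have ne: "K \<noteq> {}" and R: "R > 0"
    using assms by auto
  have cl: "closed K" and uniq: "\<And>x. infdist x K < R \<Longrightarrow> \<exists>!z. z \<in> K \<and> dist x z = infdist x K"
    using assms(1) by (auto simp: reach_at_least_iff_infdist[OF R ne])
  let ?\<xi> = "closest_point K"
  \<comment> \<open>\<open>?g\<close> sends \<open>x\<close> to the point of the sphere of radius
    \<open>s\<close> about \<open>y\<close> that lies diametrically away from
    \<open>?\<xi> x\<close>.\<close>
  let ?g = "\<lambda>x. y + (s / dist (?\<xi> x) y) *\<^sub>R (y - ?\<xi> x)"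
  note cp = closest_point_in_set[OF cl ne] dist_closest_point_eq_infdist[OF cl ne]
  have less: "infdist x K < R" if "x \<in> cball y s" for x
    using infdist_triangle[of x K y] that s by (simp add: dist_commute)
  have pos: "dist (?\<xi> x) y > 0" for x
    using infdist_le[OF cp(1), of y x] assms(4) by (subst dist_commute) linarith
  have "continuous_on (cball y s) ?\<xi>"
    using less uniq by (intro continuous_on_closest_point_unique cl ne) auto
  then have "continuous_on (cball y s) ?g"
    by (intro continuous_intros) (use pos in force)+
  moreover have g: "dist y (?g x) = s" for x
    using s pos[of x] by (simp add: dist_norm norm_minus_commute)
  ultimately obtain x where x: "x \<in> cball y s" "?g x = x"
    using brouwer_ball[of s y ?g] s by auto
  text \<open>\<open>y\<close> lies between \<open>x\<close> and its nearest point \<open>\<xi>(x)\<close>, so \<open>\<xi>(x)\<close> is also the nearest point of \<open>y\<close>.\<close>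
  have "x - ?\<xi> x = ((dist (?\<xi> x) y + s) / dist (?\<xi> x) y) *\<^sub>R (y - ?\<xi> x)"
    using pos[of x] by (subst x(2)[symmetric]) (simp add: add_divide_distrib algebra_simps)
  then have "dist x (?\<xi> x) = dist (?\<xi> x) y + s"
    using pos[of x] s by (simp add: dist_norm norm_minus_commute)
  then have sum: "infdist x K = dist y (?\<xi> x) + s"
    by (simp add: cp dist_commute)
  have "dist y x = s"
    using g[of x] x(2) by simp
  \<comment> \<open>The triangle inequality for \<open>infdist\<close> gives the upper bound,
    \<open>?\<xi> x \<in> K\<close> the lower one.\<close>
  then have "dist y (?\<xi> x) = infdist y K"
    using sum infdist_triangle[of x K y] infdist_le[OF cp(1), of y x] by (simp add: dist_commute)
  then have "?\<xi> x = p"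
    using uniq[of y] cp(1)[of x] assms(2,3) s by auto
  then show ?thesis
    using sum x(2) assms(3) by (simp add: dist_commute)
qed

text \<open>The limit case of \<open>infdist_along_ray\<close>, reached by continuity since there
  \<open>s\<close> must stay strictly below \<open>R - infdist y K\<close>.\<close>

lemma infdist_ray_endpoint:
  fixes K :: "'a::euclidean_space set"
  assumes "reach_at_least R K" "p \<in> K" "dist y p = infdist y K" "0 < infdist y K" "infdist y K < R"
  shows "infdist (y + ((R - infdist y K) / infdist y K) *\<^sub>R (y - p)) K = R"
proof -
  let ?h = "\<lambda>s. infdist (y + (s / infdist y K) *\<^sub>R (y - p)) K - (infdist y K + s)"
  let ?T = "R - infdist y K"
  have "continuous_on {0..?T} ?h"
    by (intro continuous_intros) (use assms in auto)
  moreover have "closure {0<..<?T} = {0..?T}"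
    using assms by simp
  moreover have "?h s = 0" if "s \<in> {0<..<?T}" for s
    using infdist_along_ray[OF assms(1-4), of s] that by auto
  ultimately have "?h ?T = 0"
    using assms(5) continuous_constant_on_closure[of "{0<..<?T}" ?h 0 ?T] by auto
  then show ?thesis by simp
qed

lemma reach_at_least_far_set:
  fixes K :: "'a::euclidean_space set"
  assumes R: "R > 0" and K: "reach_at_least R K"
  shows "reach_at_least R (far_set R K)"
proof (cases "K = {} \<or> far_set R K = {}")
  \<comment> \<open>For empty \<open>K\<close> all distances are infinite, so the far set is the
    whole space.\<close>
  case True
  then show ?thesis
    by (auto simp: reach_at_least_iff_ball[OF R] Unp_iff far_set_def set_distance_def)
next
  case False
  then have ne: "K \<noteq> {}" and Lne: "far_set R K \<noteq> {}"
    by auto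
  have L: "far_set R K = {x. R \<le> infdist x K}"
    by (simp add: far_set_def set_distance_eq_infdist[OF ne] infdist_nonneg)
  have cl: "closed K"
    using K by (simp add: reach_at_least_def)
  have clL: "closed (far_set R K)"
    unfolding L by (intro closed_Collect_le continuous_intros)
  have "\<exists>!x. x \<in> far_set R K \<and> dist y x = infdist y (far_set R K)"
    if y: "infdist y (far_set R K) < R" for y
  proof (cases "y \<in> far_set R K")
    case True
    then show ?thesis by auto
  next
    case False
    then have ltR: "infdist y K < R"
      by (simp add: L)
    obtain w where w: "w \<in> far_set R K" "infdist y (far_set R K) = dist y w"
      using infdist_attains_inf[OF clL Lne] by blast
    \<comment> \<open>At distance 0 from \<open>K\<close>, the point \<open>y\<close> would be at
      least \<open>R\<close> away from \<open>w\<close>.\<close>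
    have pos: "0 < infdist y K"
      using w y infdist_triangle[of w K y] by (simp add: L dist_commute)
    obtain p where p: "p \<in> K" "dist y p = infdist y K"
      using infdist_attains_inf[OF cl ne] by metis
    define z where "z = y + ((R - infdist y K) / infdist y K) *\<^sub>R (y - p)"
    have "z \<in> far_set R K"
      using infdist_ray_endpoint[OF K p pos ltR] by (simp add: L z_def)
    moreover have "dist y z = R - infdist y K"
      using pos ltR p(2) by (simp add: z_def dist_norm)
    ultimately have le: "infdist y (far_set R K) \<le> R - infdist y K"
      using infdist_le by metis
    have "x = z" if x: "x \<in> far_set R K" "dist y x = infdist y (far_set R K)" for x
    proof -
      have "R \<le> dist p x"
        using x infdist_le[OF p(1), of x] by (simp add: L dist_commute)
      then have "dist y x = R - infdist y K" "dist p x = dist p y + dist y x"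
        using x le p(2) dist_triangle[of p x y] by (simp_all add: dist_commute)
      moreover have "p \<noteq> y"
        using pos p by auto
      ultimately show ?thesis
        using dist_triangle_eq_imp_ray[of p y x] p(2) by (simp add: z_def dist_commute)
    qed
    with w show ?thesis by metis
  qed
  then show ?thesis
    using clL by (simp add: reach_at_least_iff_infdist[OF R Lne])
qed

theorem theorem4p6:
  fixes K :: "'a::euclidean_space set" and R :: real
  assumes "R > 0" and "admits_R_hull R K"
  shows "reach_at_least R (far_set R K)"
proof -
  obtain H where H: "is_R_hull R K H"
    using assms(2) by (auto simp: admits_R_hull_def)
  then have "reach_at_least R (far_set R H)"
    using reach_at_least_far_set[OF assms(1)] unfolding is_R_hull_def by blast
  then show ?thesis
    by (simp add: far_set_R_hull[OF assms(1) H])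
qed

end
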